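(* Let $T$ be a tree of order $n$ with $\operatorname{diam}(T)\geq 3$. Then $\gamma_{t,coi}(T)=n-\beta(T)$ if and only if $T$ belongs to the family $\mathcal{T}$ consisting of the path $P_4$ together with all trees obtainable from $P_4$ by a finite sequence of the operations $O_1,O_2,O_3,O_4$ described below, where each operation is applied to the current tree $T'$: (O1) add a new vertex and join it to a vertex of $T'$ that belongs to some $\gamma_{t,coi}(T')$-set; (O2) add a new path $P_2$ and join one of its vertices to a vertex of $T'$ that belongs to some $\gamma_{t,coi}(T')$-set; (O3) add a new path $P_4=h_1u_1u_2h_2$ and join the leaf $h_1$ to a vertex $v$ of $T'$ that belongs to some $\gamma_{t,coi}(T')$-set; (O4) add a new path $P_4=h_1u_1u_2h_2$ and join the support vertex $u_1$ to a vertex $v$ of $T'$ that belongs to some maximum independent set of $T'$.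
   Context: All graphs are finite, simple and undirected. For a graph $G$, a set $D\subseteq V(G)$ is a total dominating set if every vertex of $G$ has at least one neighbor in $D$. A total dominating set $D$ is a total co-independent dominating set if $V(G)\setminus D$ is nonempty and independent. $\gamma_{t,coi}(G)$ is the minimum cardinality of a total co-independent dominating set of $G$; a $\gamma_{t,coi}(G)$-set is one of that cardinality. $\beta(G)$ is the maximum cardinality of an independent set of $G$. In a tree, a leaf is a vertex of degree one and a support vertex is a non-leaf vertex adjacent to a leaf. *)

theory Defs
  imports "Graph_Theory.Graph_Theory"
begin

text \<open>
  A finite simple undirected graph is a \<^locale>\<open>pair_graph\<close>: an edge joining u and v is
  represented by the two arcs (u,v) and (v,u).
\<close>

text \<open>
  The predicate \<^const>\<open>tree\<close> of the library is unsuitable here: under the symmetric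
  representation a single edge already yields the closed walk (u,v),(v,u), which
  \<^const>\<open>pre_digraph.cycle\<close> accepts. Cycles of an undirected simple graph are those of
  length at least 3.
\<close>
definition undirected_tree :: "'a pair_pre_digraph \<Rightarrow> bool" where
  "undirected_tree G \<longleftrightarrow>
     pair_graph G \<and> connected (with_proj G) \<and>
     \<not> (\<exists>p. pre_digraph.cycle (with_proj G) p \<and> 3 \<le> length p)"

text \<open>With unit arc costs, \<^const>\<open>wf_digraph.\<mu>\<close> is the usual graph distance.\<close>
definition diameter :: "'a pair_pre_digraph \<Rightarrow> ereal" where
  "diameter G = (SUP u\<in>pverts G. SUP v\<in>pverts G. wf_digraph.\<mu> (with_proj G) (\<lambda>_. 1) u v)"

definition independent_set :: "'a pair_pre_digraph \<Rightarrow> 'a set \<Rightarrow> bool" where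
  "independent_set G S \<longleftrightarrow> S \<subseteq> pverts G \<and> (\<forall>u\<in>S. \<forall>v\<in>S. (u, v) \<notin> parcs G)"

definition independence_number :: "'a pair_pre_digraph \<Rightarrow> nat" where
  "independence_number G = Max (card ` {S. independent_set G S})"

definition maximum_independent_set :: "'a pair_pre_digraph \<Rightarrow> 'a set \<Rightarrow> bool" where
  "maximum_independent_set G S \<longleftrightarrow> independent_set G S \<and> card S = independence_number G"

definition total_dominating_set :: "'a pair_pre_digraph \<Rightarrow> 'a set \<Rightarrow> bool" where
  "total_dominating_set G D \<longleftrightarrow>
     D \<subseteq> pverts G \<and> (\<forall>v\<in>pverts G. \<exists>u\<in>D. (v, u) \<in> parcs G)"

definition total_coindependent_dominating_set :: "'a pair_pre_digraph \<Rightarrow> 'a set \<Rightarrow> bool" where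
  "total_coindependent_dominating_set G D \<longleftrightarrow>
     total_dominating_set G D \<and> pverts G - D \<noteq> {} \<and> independent_set G (pverts G - D)"

definition gamma_tcoi :: "'a pair_pre_digraph \<Rightarrow> nat" where
  "gamma_tcoi G = Min (card ` {D. total_coindependent_dominating_set G D})"

definition gamma_tcoi_set :: "'a pair_pre_digraph \<Rightarrow> 'a set \<Rightarrow> bool" where
  "gamma_tcoi_set G D \<longleftrightarrow>
     total_coindependent_dominating_set G D \<and> card D = gamma_tcoi G"

definition path_graph :: "'a list \<Rightarrow> 'a pair_pre_digraph" where
  "path_graph xs =
     \<lparr> pverts = set xs, parcs = set (zip xs (tl xs)) \<union> (set (zip xs (tl xs)))\<inverse> \<rparr>"

definition join_by_edge ::
  "'a pair_pre_digraph \<Rightarrow> 'a \<Rightarrow> 'a pair_pre_digraph \<Rightarrow> 'a \<Rightarrow> 'a pair_pre_digraph" where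
  "join_by_edge G v H h =
     \<lparr> pverts = pverts G \<union> pverts H, parcs = parcs G \<union> parcs H \<union> {(v, h), (h, v)} \<rparr>"

text \<open>
  Vertex names are arbitrary in every rule, so the family is closed under isomorphism. All trees
  of a construction sequence live on the type of the final tree; this is no restriction, since
  each of them is a subgraph of the final one.
\<close>
inductive family_T :: "'a pair_pre_digraph \<Rightarrow> bool" where
  P4: "distinct [a, b, c, d] \<Longrightarrow> family_T (path_graph [a, b, c, d])"
| O1: "\<lbrakk> family_T T'; gamma_tcoi_set T' D; v \<in> D; x \<notin> pverts T' \<rbrakk>
    \<Longrightarrow> family_T (join_by_edge T' v (path_graph [x]) x)"
| O2: "\<lbrakk> family_T T'; gamma_tcoi_set T' D; v \<in> D;
         distinct [x, y]; set [x, y] \<inter> pverts T' = {} \<rbrakk>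
    \<Longrightarrow> family_T (join_by_edge T' v (path_graph [x, y]) x)"
| O3: "\<lbrakk> family_T T'; gamma_tcoi_set T' D; v \<in> D;
         distinct [h1, u1, u2, h2]; set [h1, u1, u2, h2] \<inter> pverts T' = {} \<rbrakk>
    \<Longrightarrow> family_T (join_by_edge T' v (path_graph [h1, u1, u2, h2]) h1)"
| O4: "\<lbrakk> family_T T'; maximum_independent_set T' S; v \<in> S;
         distinct [h1, u1, u2, h2]; set [h1, u1, u2, h2] \<inter> pverts T' = {} \<rbrakk>
    \<Longrightarrow> family_T (join_by_edge T' v (path_graph [h1, u1, u2, h2]) u1)"

end

theory Submission
  imports Defs
begin

text \<open>
  Since the complement of a total co-independent dominating set is independent, the equation
  \<open>gamma_tcoi T = n - independence_number T\<close> says that some maximum independent set \<open>S\<close> has a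
  totally dominating complement. Each of the four operations preserves this property: \<open>S\<close> is
  enlarged by one vertex (O1, O2) or two vertices (O3, O4), which is also the independence
  number of the attached path.

  Conversely, let \<open>S\<close> be such a set. Every leaf lies in \<open>S\<close> and its neighbour does not. Root the tree
  anywhere and follow the parents \<open>x1\<close>, \<open>x2\<close>, \<open>x3\<close>, \<open>x4\<close> of a deepest vertex \<open>x0\<close>; then \<open>x1\<close> and
  \<open>x2\<close> are not in \<open>S\<close>. If some vertex has two leaf neighbours, one of them can be removed (O1).
  Otherwise \<open>x1\<close> has degree two. If \<open>x2\<close> has a neighbour other than \<open>x1\<close> outside \<open>S\<close>, then \<open>x0\<close> and
  \<open>x1\<close> can be removed (O2). Otherwise the only possible further child of \<open>x2\<close> is a leaf \<open>c\<close>. If \<open>c\<close>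
  exists, the path \<open>c x2 x1 x0\<close> can be removed (O4). If not, \<open>x3\<close> is in \<open>S\<close>, and a second child
  \<open>w\<close> of \<open>x3\<close> would allow to exchange \<open>x3\<close> for \<open>x2\<close> and \<open>w\<close> in \<open>S\<close>; so \<open>x3\<close> has degree at most two and
  the path \<open>x3 x2 x1 x0\<close> can be removed (O3). When the root is reached prematurely, the tree is \<open>P4\<close>.
\<close>

section \<open>Maximum independent sets and the equation for \<open>gamma_tcoi\<close>\<close>

lemma finite_independent_sets: "finite (pverts G) \<Longrightarrow> finite {S. independent_set G S}"
  by (rule finite_subset[of _ "Pow (pverts G)"]) (auto simp: independent_set_def)

lemma card_le_independence_number:
  "finite (pverts G) \<Longrightarrow> independent_set G S \<Longrightarrow> card S \<le> independence_number G"
  unfolding independence_number_def by (intro Max_ge) (auto intro: finite_independent_sets)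

text \<open>Finiteness allows trading the \<open>Max\<close> for a comparison of cardinalities, the
  form in which maximality is used below.\<close>

lemma maximum_independent_set_iff:
  assumes "finite (pverts G)"
  shows "maximum_independent_set G S \<longleftrightarrow>
    independent_set G S \<and> (\<forall>A. independent_set G A \<longrightarrow> card A \<le> card S)"
proof -
  have "independence_number G = card S"
    if "independent_set G S" "\<forall>A. independent_set G A \<longrightarrow> card A \<le> card S"
    unfolding independence_number_def
    using that finite_independent_sets[OF assms] by (intro Max_eqI) auto
  with card_le_independence_number[OF assms] show ?thesis
    unfolding maximum_independent_set_def by auto
qed

text \<open>When the equation holds, complements of \<open>gamma_tcoi\<close> sets are of this kind.
  On the independent side, counting is additive under joins and free of truncated subtraction.
  \<open>S \<noteq> {}\<close>, which co-independence asks for, is carried separately.\<close>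

definition co_total_independent :: "'a pair_pre_digraph \<Rightarrow> 'a set \<Rightarrow> bool" where
  "co_total_independent G S \<longleftrightarrow> maximum_independent_set G S \<and> total_dominating_set G (pverts G - S)"

lemma gamma_tcoi_set_min:
  assumes "finite (pverts G)" "total_coindependent_dominating_set G D"
  shows "\<exists>D'. gamma_tcoi_set G D'" "gamma_tcoi G \<le> card D"
proof -
  let ?F = "card ` {D. total_coindependent_dominating_set G D}"
  have "D \<subseteq> pverts G" if "total_coindependent_dominating_set G D" for D
    using that by (simp add: total_coindependent_dominating_set_def total_dominating_set_def)
  then have "{D. total_coindependent_dominating_set G D} \<subseteq> Pow (pverts G)" by blast
  then have "finite {D. total_coindependent_dominating_set G D}"
    using assms(1) by (meson finite_Pow_iff finite_subset)
  then have fin: "finite ?F" by (rule finite_imageI)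
  then show "gamma_tcoi G \<le> card D"
    unfolding gamma_tcoi_def using assms(2) by (intro Min_le) auto
  have "Min ?F \<in> ?F"
    using fin assms(2) by (intro Min_in) auto
  then show "\<exists>D'. gamma_tcoi_set G D'"
    unfolding gamma_tcoi_set_def gamma_tcoi_def by auto
qed

lemma card_coindependent_ge:
  assumes "finite (pverts G)" "total_coindependent_dominating_set G D"
  shows "card (pverts G) - independence_number G \<le> card D"
proof -
  have "D \<subseteq> pverts G" and ind: "independent_set G (pverts G - D)"
    using assms(2)
    by (auto simp: total_coindependent_dominating_set_def total_dominating_set_def)
  then have "card (pverts G - D) = card (pverts G) - card D"
    using assms(1) by (meson card_Diff_subset finite_subset)
  with card_le_independence_number[OF assms(1) ind] show ?thesis by linarith
qed

text \<open>Every total co-independent dominating set has an independent complement, so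
  \<open>card_coindependent_ge\<close> bounds \<open>gamma_tcoi G\<close> from below;
  \<open>pverts G - S\<close> attains the bound.\<close>

lemma co_total_independent_gamma_tcoi_set:
  assumes fin: "finite (pverts G)" and wc: "co_total_independent G S" and "S \<noteq> {}"
  shows "gamma_tcoi_set G (pverts G - S)"
    and "gamma_tcoi G = card (pverts G) - independence_number G"
proof -
  have S: "independent_set G S" "S \<subseteq> pverts G" "card S = independence_number G"
    using wc by (auto simp: co_total_independent_def maximum_independent_set_def independent_set_def)
  then have "pverts G - (pverts G - S) = S" by blast
  with wc S \<open>S \<noteq> {}\<close> have tc: "total_coindependent_dominating_set G (pverts G - S)"
    by (simp add: total_coindependent_dominating_set_def co_total_independent_def)
  have card: "card (pverts G - S) = card (pverts G) - independence_number G"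
    using S fin by (metis card_Diff_subset finite_subset)
  obtain D where D: "gamma_tcoi_set G D" using gamma_tcoi_set_min(1)[OF fin tc] ..
  then have "card (pverts G) - independence_number G \<le> gamma_tcoi G"
    using card_coindependent_ge[OF fin, of D] by (simp add: gamma_tcoi_set_def)
  with gamma_tcoi_set_min(2)[OF fin tc] card
  show "gamma_tcoi G = card (pverts G) - independence_number G" by simp
  with tc card show "gamma_tcoi_set G (pverts G - S)" by (simp add: gamma_tcoi_set_def)
qed

text \<open>The equation forces the independent complement of \<open>D\<close> to be as large as
  possible. An actual \<open>D\<close> has to be supplied, because \<open>gamma_tcoi\<close> is the
  \<open>Min\<close> of a set that may be empty.\<close>

lemma gamma_tcoi_set_co_total_independent:
  assumes fin: "finite (pverts G)" and D: "gamma_tcoi_set G D"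
    and eq: "gamma_tcoi G = card (pverts G) - independence_number G"
  shows "co_total_independent G (pverts G - D)"
proof -
  have ind: "independent_set G (pverts G - D)" and td: "total_dominating_set G D"
    and sub: "D \<subseteq> pverts G" and cD: "card D = gamma_tcoi G"
    using D by (auto simp: gamma_tcoi_set_def total_coindependent_dominating_set_def
        total_dominating_set_def)
  have "card (pverts G - D) = card (pverts G) - card D" "card D \<le> card (pverts G)"
    using sub fin by (auto simp: card_Diff_subset finite_subset card_mono)
  moreover have "card (pverts G - D) \<le> independence_number G"
    using card_le_independence_number[OF fin ind] .
  \<comment> \<open>With this bound the subtraction in \<open>eq\<close> is not truncated.\<close>
  moreover have "independence_number G \<le> card (pverts G)"
  proof -
    have "independence_number G \<in> card ` {S. independent_set G S}"
      unfolding independence_number_def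
      using ind finite_independent_sets[OF fin] by (intro Max_in) auto
    then show ?thesis using fin by (auto simp: independent_set_def card_mono)
  qed
  ultimately have "card (pverts G - D) = independence_number G"
    using cD eq by linarith
  moreover have "pverts G - (pverts G - D) = D" using sub by blast
  ultimately show ?thesis
    using ind td by (simp add: co_total_independent_def maximum_independent_set_def)
qed

section \<open>Joining a path to a graph by one edge\<close>

lemma pverts_path_graph [simp]: "pverts (path_graph xs) = set xs"
  by (simp add: path_graph_def)

lemma parcs_path_graph [simp]:
  "parcs (path_graph [a]) = {}"
  "parcs (path_graph [a, b]) = {(a, b), (b, a)}"
  "parcs (path_graph [a, b, c, d]) = {(a, b), (b, a), (b, c), (c, b), (c, d), (d, c)}"
  by (auto simp: path_graph_def)

lemma join_by_edge_simps [simp]: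
  "pverts (join_by_edge G v H h) = pverts G \<union> pverts H"
  "parcs (join_by_edge G v H h) = parcs G \<union> parcs H \<union> {(v, h), (h, v)}"
  by (simp_all add: join_by_edge_def)

lemma parcs_path_graph_subset: "parcs (path_graph xs) \<subseteq> set xs \<times> set xs"
proof -
  have "set (zip xs (tl xs)) \<subseteq> set xs \<times> set xs"
    by (cases xs) (auto dest: set_zip_leftD set_zip_rightD)
  then show ?thesis by (auto simp: path_graph_def)
qed

lemma parcs_join_by_edge_subset:
  assumes "parcs G \<subseteq> pverts G \<times> pverts G" "parcs H \<subseteq> pverts H \<times> pverts H"
    and "v \<in> pverts G" "h \<in> pverts H"
  shows "parcs (join_by_edge G v H h) \<subseteq> pverts (join_by_edge G v H h) \<times> pverts (join_by_edge G v H h)"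
  using assms by (simp add: subset_iff)

text \<open>An independent set of the join splits into independent sets of the two parts, so none
  exceeds \<open>card S + card A\<close>; \<open>no_edge\<close> keeps the new edge from lying
  inside the union.\<close>

lemma maximum_independent_set_join_by_edge:
  assumes fin: "finite (pverts G)" "finite (pverts H)"
    and wf: "parcs G \<subseteq> pverts G \<times> pverts G" "parcs H \<subseteq> pverts H \<times> pverts H"
    and disj: "pverts G \<inter> pverts H = {}" and vh: "v \<in> pverts G" "h \<in> pverts H"
    and S: "maximum_independent_set G S" and A: "maximum_independent_set H A"
    and no_edge: "v \<notin> S \<or> h \<notin> A"
  shows "maximum_independent_set (join_by_edge G v H h) (S \<union> A)"
proof -
  let ?J = "join_by_edge G v H h"
  have finJ: "finite (pverts ?J)" using fin by simp
  have indS: "independent_set G S" and maxS: "\<And>B. independent_set G B \<Longrightarrow> card B \<le> card S"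
    and indA: "independent_set H A" and maxA: "\<And>B. independent_set H B \<Longrightarrow> card B \<le> card A"
    using S A fin by (auto simp: maximum_independent_set_iff)
  have sub: "S \<subseteq> pverts G" "A \<subseteq> pverts H" using indS indA by (auto simp: independent_set_def)
  have ind: "independent_set ?J (S \<union> A)"
    unfolding independent_set_def
  proof (intro conjI ballI)
    show "S \<union> A \<subseteq> pverts ?J" using sub by auto
    fix x y assume xy: "x \<in> S \<union> A" "y \<in> S \<union> A"
    have "(x, y) \<notin> parcs G"
      using xy indS sub wf(1) disj unfolding independent_set_def by blast
    moreover have "(x, y) \<notin> parcs H"
      using xy indA sub wf(2) disj unfolding independent_set_def by blast
    moreover have "(x, y) \<notin> {(v, h), (h, v)}"
      using xy sub disj vh no_edge by blast
    ultimately show "(x, y) \<notin> parcs ?J" by simp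
  qed
  have "card B \<le> card (S \<union> A)" if B: "independent_set ?J B" for B
  proof -
    have "independent_set G (B \<inter> pverts G)" "independent_set H (B \<inter> pverts H)"
      using B by (auto simp: independent_set_def)
    then have "card (B \<inter> pverts G) + card (B \<inter> pverts H) \<le> card S + card A"
      using maxS maxA by (meson add_mono)
    also have "\<dots> = card (S \<union> A)"
      using sub fin disj by (intro card_Un_disjoint[symmetric]) (auto intro: finite_subset)
    finally have *: "card (B \<inter> pverts G) + card (B \<inter> pverts H) \<le> card (S \<union> A)" .
    have "B = (B \<inter> pverts G) \<union> (B \<inter> pverts H)"
      using B by (auto simp: independent_set_def)
    then have "card B \<le> card (B \<inter> pverts G) + card (B \<inter> pverts H)"
      by (metis card_Un_le)
    with * show ?thesis by linarith
  qed
  with ind show ?thesis by (simp add: maximum_independent_set_iff[OF finJ])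
qed

lemma maximum_independent_set_path_graph_1: "maximum_independent_set (path_graph [x]) {x}"
proof -
  have "card A \<le> card {x}" if "independent_set (path_graph [x]) A" for A
    using that by (intro card_mono) (auto simp: independent_set_def)
  moreover have "independent_set (path_graph [x]) {x}"
    by (simp add: independent_set_def)
  ultimately show ?thesis by (simp add: maximum_independent_set_iff)
qed

text \<open>Of the two possible singletons, the far end \<open>y\<close> serves O2: \<open>x\<close>
  stays outside the set and dominates \<open>y\<close>, while \<open>x\<close> itself is dominated
  by \<open>v\<close>.\<close>

lemma maximum_independent_set_path_graph_2:
  assumes "x \<noteq> y"
  shows "maximum_independent_set (path_graph [x, y]) {y}"
proof -
  have "card A \<le> card {y}" if A: "independent_set (path_graph [x, y]) A" for A
  proof -
    have "A \<subseteq> {x, y}" "\<not> (x \<in> A \<and> y \<in> A)"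
      using A by (auto simp: independent_set_def)
    then have "A \<subseteq> {x} \<or> A \<subseteq> {y}" by blast
    then show ?thesis by (auto dest!: subset_singletonD)
  qed
  moreover have "independent_set (path_graph [x, y]) {y}"
    using assms by (simp add: independent_set_def)
  ultimately show ?thesis by (simp add: maximum_independent_set_iff)
qed

text \<open>The edges from \<open>a\<close> to \<open>b\<close> and from \<open>c\<close> to
  \<open>d\<close> cover the path, and each contributes at most one vertex. The two ends are chosen
  because \<open>b\<close> and \<open>c\<close> totally dominate the path.\<close>

lemma maximum_independent_set_path_graph_4:
  assumes "distinct [a, b, c, d]"
  shows "maximum_independent_set (path_graph [a, b, c, d]) {a, d}"
proof -
  have le1: "card B \<le> 1" if "B \<subseteq> {x}" for B :: "'a set" and x
    using card_mono[OF _ that] by simp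
  have "card A \<le> card {a, d}" if A: "independent_set (path_graph [a, b, c, d]) A" for A
  proof -
    have sub: "A \<subseteq> {a, b, c, d}" and "\<not> (a \<in> A \<and> b \<in> A)" "\<not> (c \<in> A \<and> d \<in> A)"
      using A by (auto simp: independent_set_def)
    then have "A \<inter> {a, b} \<subseteq> {a} \<or> A \<inter> {a, b} \<subseteq> {b}"
      and "A \<inter> {c, d} \<subseteq> {c} \<or> A \<inter> {c, d} \<subseteq> {d}"
      by blast+
    then have "card (A \<inter> {a, b}) \<le> 1" "card (A \<inter> {c, d}) \<le> 1"
      using le1 by metis+
    moreover have "A = (A \<inter> {a, b}) \<union> (A \<inter> {c, d})"
      using sub by blast
    then have "card A \<le> card (A \<inter> {a, b}) + card (A \<inter> {c, d})"
      by (metis card_Un_le)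
    ultimately show ?thesis using assms by simp
  qed
  moreover have "independent_set (path_graph [a, b, c, d]) {a, d}"
    using assms by (auto simp: independent_set_def)
  ultimately show ?thesis by (simp add: maximum_independent_set_iff)
qed

text \<open>Old vertices keep their dominators. By \<open>dom\<close>, new ones are dominated inside
  \<open>H\<close>, except that \<open>h\<close> may rely on \<open>v\<close> across the new
  edge.\<close>

lemma co_total_independent_join_by_edge:
  assumes fin: "finite (pverts G)" "finite (pverts H)"
    and wf: "parcs G \<subseteq> pverts G \<times> pverts G" "parcs H \<subseteq> pverts H \<times> pverts H"
    and disj: "pverts G \<inter> pverts H = {}" and vh: "v \<in> pverts G" "h \<in> pverts H"
    and S: "co_total_independent G S" and A: "maximum_independent_set H A"
    and no_edge: "v \<notin> S \<or> h \<notin> A"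
    and dom: "\<And>x. x \<in> pverts H \<Longrightarrow> (\<exists>u\<in>pverts H - A. (x, u) \<in> parcs H) \<or> x = h \<and> v \<notin> S"
  shows "co_total_independent (join_by_edge G v H h) (S \<union> A)"
proof -
  have S': "maximum_independent_set G S"
    and td: "\<And>x. x \<in> pverts G \<Longrightarrow> \<exists>u\<in>pverts G - S. (x, u) \<in> parcs G"
    using S by (auto simp: co_total_independent_def total_dominating_set_def)
  have sub: "S \<subseteq> pverts G" "A \<subseteq> pverts H"
    using S' A by (auto simp: maximum_independent_set_def independent_set_def)
  let ?J = "join_by_edge G v H h"
  have "\<exists>u\<in>pverts ?J - (S \<union> A). (x, u) \<in> parcs ?J" if x: "x \<in> pverts ?J" for x
  proof (cases "x \<in> pverts G")
    case True
    with td[OF True] sub disj show ?thesis by auto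
  next
    case False
    with x have "x \<in> pverts H" by simp
    with dom[OF this] sub disj vh show ?thesis by auto
  qed
  then have "total_dominating_set ?J (pverts ?J - (S \<union> A))"
    unfolding total_dominating_set_def by blast
  with maximum_independent_set_join_by_edge[OF fin wf disj vh S' A no_edge] show ?thesis
    by (simp add: co_total_independent_def)
qed

section \<open>Members of the family satisfy the equation\<close>

text \<open>Finiteness and well-formedness of the arcs are carried along because the rules of
  \<open>family_T\<close> do not state them. A nonempty \<open>S\<close> gives the equation for the
  current tree, and the equation makes the complement of the \<open>D\<close> named in the rule a
  set of the same kind.\<close>

lemma family_T_co_total_independent:
  assumes "family_T G"
  shows "finite (pverts G) \<and> parcs G \<subseteq> pverts G \<times> pverts G \<and>
    (\<exists>S. S \<noteq> {} \<and> co_total_independent G S)"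
  using assms
proof induction
  case (P4 a b c d)
  have "co_total_independent (path_graph [a, b, c, d]) {a, d}"
    using P4 maximum_independent_set_path_graph_4[OF P4]
    by (auto simp: co_total_independent_def total_dominating_set_def)
  then show ?case by (intro conjI exI[of _ "{a, d}"]) auto
next
  case (O1 G D v x)
  then have fin: "finite (pverts G)" and wf: "parcs G \<subseteq> pverts G \<times> pverts G" by auto
  from O1 have wc: "co_total_independent G (pverts G - D)"
    using gamma_tcoi_set_co_total_independent co_total_independent_gamma_tcoi_set(2) by blast
  have D: "D \<subseteq> pverts G"
    using O1(2) by (auto simp: gamma_tcoi_set_def total_coindependent_dominating_set_def
        total_dominating_set_def)
  let ?J = "join_by_edge G v (path_graph [x]) x"
  have "co_total_independent ?J ((pverts G - D) \<union> {x})"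
    using O1.hyps(3-) D wf wc parcs_path_graph_subset
    by (intro co_total_independent_join_by_edge fin maximum_independent_set_path_graph_1) auto
  then have "\<exists>S. S \<noteq> {} \<and> co_total_independent ?J S"
    by (intro exI[of _ "(pverts G - D) \<union> {x}"]) simp
  moreover have "parcs ?J \<subseteq> pverts ?J \<times> pverts ?J"
    using wf D O1.hyps(3) parcs_path_graph_subset by (intro parcs_join_by_edge_subset) auto
  ultimately show ?case using fin by simp
next
  case (O2 G D v x y)
  then have fin: "finite (pverts G)" and wf: "parcs G \<subseteq> pverts G \<times> pverts G" by auto
  from O2 have wc: "co_total_independent G (pverts G - D)"
    using gamma_tcoi_set_co_total_independent co_total_independent_gamma_tcoi_set(2) by blast
  have D: "D \<subseteq> pverts G"
    using O2(2) by (auto simp: gamma_tcoi_set_def total_coindependent_dominating_set_def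
        total_dominating_set_def)
  let ?J = "join_by_edge G v (path_graph [x, y]) x"
  have "co_total_independent ?J ((pverts G - D) \<union> {y})"
    using O2.hyps(3-) D wf wc parcs_path_graph_subset
    by (intro co_total_independent_join_by_edge fin maximum_independent_set_path_graph_2) auto
  then have "\<exists>S. S \<noteq> {} \<and> co_total_independent ?J S"
    by (intro exI[of _ "(pverts G - D) \<union> {y}"]) simp
  moreover have "parcs ?J \<subseteq> pverts ?J \<times> pverts ?J"
    using wf D O2.hyps(3) parcs_path_graph_subset by (intro parcs_join_by_edge_subset) auto
  ultimately show ?case using fin by simp
next
  case (O3 G D v h1 u1 u2 h2)
  then have fin: "finite (pverts G)" and wf: "parcs G \<subseteq> pverts G \<times> pverts G" by auto
  from O3 have wc: "co_total_independent G (pverts G - D)"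
    using gamma_tcoi_set_co_total_independent co_total_independent_gamma_tcoi_set(2) by blast
  have D: "D \<subseteq> pverts G"
    using O3(2) by (auto simp: gamma_tcoi_set_def total_coindependent_dominating_set_def
        total_dominating_set_def)
  let ?J = "join_by_edge G v (path_graph [h1, u1, u2, h2]) h1"
  have "co_total_independent ?J ((pverts G - D) \<union> {h1, h2})"
    using O3.hyps(3-) D wf wc parcs_path_graph_subset
    by (intro co_total_independent_join_by_edge fin maximum_independent_set_path_graph_4) auto
  then have "\<exists>S. S \<noteq> {} \<and> co_total_independent ?J S"
    by (intro exI[of _ "(pverts G - D) \<union> {h1, h2}"]) simp
  moreover have "parcs ?J \<subseteq> pverts ?J \<times> pverts ?J"
    using wf D O3.hyps(3) parcs_path_graph_subset by (intro parcs_join_by_edge_subset) auto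
  ultimately show ?case using fin by simp
next
  case (O4 G S v h1 u1 u2 h2)
  then have fin: "finite (pverts G)" and wf: "parcs G \<subseteq> pverts G \<times> pverts G" by auto
  \<comment> \<open>Only a set \<open>S0\<close> from the induction hypothesis is known to have a
    totally dominating complement. Adding \<open>h1\<close> and \<open>h2\<close> keeps it
    independent, since the new edge ends in \<open>u1\<close>.\<close>
  from O4 obtain S0 where S0: "co_total_independent G S0" by blast
  have v: "v \<in> pverts G" using O4 by (auto simp: maximum_independent_set_def independent_set_def)
  let ?J = "join_by_edge G v (path_graph [h1, u1, u2, h2]) u1"
  have "co_total_independent ?J (S0 \<union> {h1, h2})"
    using O4.hyps(3-) v wf S0 parcs_path_graph_subset
    by (intro co_total_independent_join_by_edge fin maximum_independent_set_path_graph_4) auto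
  then have "\<exists>S. S \<noteq> {} \<and> co_total_independent ?J S"
    by (intro exI[of _ "S0 \<union> {h1, h2}"]) simp
  moreover have "parcs ?J \<subseteq> pverts ?J \<times> pverts ?J"
    using wf v O4.hyps(3) parcs_path_graph_subset by (intro parcs_join_by_edge_subset) auto
  ultimately show ?case using fin by simp
qed

section \<open>Rooting a tree\<close>

text \<open>Depth grows from parent to child, which excludes cycles. \<open>p\<close> and
  \<open>d\<close> are unconstrained outside the vertex set, so the same functions root every
  induced subgraph left after deleting a set that is closed under children and avoids the
  root.\<close>

definition rooted_tree :: "'a pair_pre_digraph \<Rightarrow> 'a \<Rightarrow> ('a \<Rightarrow> 'a) \<Rightarrow> ('a \<Rightarrow> nat) \<Rightarrow> bool" where
  "rooted_tree G r p d \<longleftrightarrow>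
     finite (pverts G) \<and> r \<in> pverts G \<and>
     (\<forall>u\<in>pverts G. u \<noteq> r \<longrightarrow> p u \<in> pverts G \<and> d u = Suc (d (p u))) \<and>
     (\<forall>u v. (u, v) \<in> parcs G \<longleftrightarrow>
        u \<in> pverts G \<and> v \<in> pverts G \<and> (u \<noteq> r \<and> v = p u \<or> v \<noteq> r \<and> u = p v))"

lemma pair_graph_arcs_sym:
  assumes "pair_graph G" "(u, v) \<in> parcs G"
  shows "(v, u) \<in> parcs G"
proof -
  interpret pair_graph G by fact
  show ?thesis using assms(2) graph_symmetric by auto
qed

lemma undirected_tree_reachable:
  assumes "undirected_tree G" "u \<in> pverts G" "v \<in> pverts G"
  shows "u \<rightarrow>\<^sup>*\<^bsub>with_proj G\<^esub> v"
proof -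
  have "pair_graph G" and conn: "connected (with_proj G)"
    using assms(1) by (auto simp: undirected_tree_def)
  interpret pair_graph G by fact
  show ?thesis
    using conn assms(2,3) reachable_mk_symmetric_eq[OF pair_sym_arcs]
    by (auto simp: connected_def strongly_connected_def)
qed

text \<open>A path from \<open>v\<close> to \<open>u\<close> avoiding the edge would close up with
  it to a cycle. The path has at least two arcs, because \<open>u \<noteq> v\<close> and the arc
  \<open>(v, u)\<close> is deleted, so the cycle has the forbidden length.\<close>

lemma undirected_tree_bridge:
  assumes tree: "undirected_tree G" and uv: "(u, v) \<in> parcs G"
  shows "(v, u) \<notin> (parcs G - {(u, v), (v, u)})\<^sup>*"
proof
  assume path: "(v, u) \<in> (parcs G - {(u, v), (v, u)})\<^sup>*"
  have "pair_graph G" using tree by (simp add: undirected_tree_def)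
  interpret G: pair_graph G by fact
  define H where "H = \<lparr>pverts = pverts G, parcs = parcs G - {(u, v), (v, u)}\<rparr>"
  have pH: "pverts H = pverts G" "parcs H = parcs G - {(u, v), (v, u)}"
    by (simp_all add: H_def)
  interpret H: pair_wf_digraph H
    by unfold_locales (auto simp: pH dest: G.arc_fst_in_verts G.arc_snd_in_verts)
  have inV: "u \<in> pverts G" "v \<in> pverts G" "u \<noteq> v"
    using G.in_arcsD1[OF uv] G.in_arcsD2[OF uv] G.pair_no_loops[OF uv] by auto
  have "v \<rightarrow>\<^sup>*\<^bsub>with_proj H\<^esub> u"
    using path
  proof induction
    case base
    show ?case using inV by (simp add: pH)
  next
    case (step y z)
    then have "(y, z) \<in> parcs H" by (simp add: pH)
    then show ?case using step.IH H.reachable_adj_trans by auto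
  qed
  then obtain q where q: "H.apath v q u" using H.reachable_apath by blast
  then have sub: "set q \<subseteq> parcs H" and cas: "pcas v q u" and dist: "distinct (pawalk_verts v q)"
    by (auto simp: H.apath_def H.awalk_def)
  have "G.awalk u ((u, v) # q) u"
    using uv sub cas inV by (auto simp: G.awalk_def pH)
  then have "G.cycle ((u, v) # q)"
    using dist by (auto simp: G.cycle_def)
  moreover have "3 \<le> length ((u, v) # q)"
  proof -
    have "q \<noteq> []" using cas inV by auto
    moreover have "length q \<noteq> 1"
    proof
      assume "length q = 1"
      then obtain e where "q = [e]" by (metis One_nat_def length_0_conv length_Suc_conv)
      with cas have "q = [(v, u)]" by (cases e) auto
      with sub show False by (simp add: pH)
    qed
    ultimately have "2 \<le> length q" by (cases q; cases "tl q") auto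
    then show ?thesis by simp
  qed
  ultimately show False using tree unfolding undirected_tree_def by blast
qed

text \<open>Breadth-first layers: depth is the distance from \<open>r\<close>, and a parent is some
  neighbour one layer closer. The bridge property excludes edges inside a layer and second
  parents.\<close>

lemma undirected_tree_rooted:
  assumes tree: "undirected_tree G" and r: "r \<in> pverts G"
  shows "\<exists>p d. rooted_tree G r p d"
proof -
  have "pair_graph G" using tree by (simp add: undirected_tree_def)
  interpret G: pair_graph G by fact
  let ?E = "parcs G"
  define d where "d u = (LEAST n. (r, u) \<in> ?E ^^ n)" for u
  define p where "p u = (SOME w. (w, u) \<in> ?E \<and> d u = Suc (d w))" for u
  have sym: "(y, x) \<in> ?E" if "(x, y) \<in> ?E" for x y
    using pair_graph_arcs_sym[OF \<open>pair_graph G\<close> that] .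
  have d_path: "(r, u) \<in> ?E ^^ d u" if "u \<in> pverts G" for u
  proof -
    have "(r, u) \<in> ?E\<^sup>*"
      using undirected_tree_reachable[OF tree r that]
      by (auto simp: reachable_def dest: rtrancl_on_rtranclI)
    then show ?thesis unfolding d_def by (metis LeastI rtrancl_imp_relpow)
  qed
  have d_le: "d u \<le> n" if "(r, u) \<in> ?E ^^ n" for u n
    unfolding d_def using that by (rule Least_le)
  have d_step: "d v \<le> Suc (d u)" if "(u, v) \<in> ?E" for u v
    using d_path[of u] that G.in_arcsD1 by (intro d_le) auto
  have d_r: "d r = 0" using d_le[of r 0] by simp
  have ex_p: "\<exists>w. (w, u) \<in> ?E \<and> d u = Suc (d w)" if u: "u \<in> pverts G" "u \<noteq> r" for u
  proof -
    have "d u \<noteq> 0" using d_path[OF u(1)] u(2) by (cases "d u") auto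
    then obtain n where n: "d u = Suc n" using not0_implies_Suc by blast
    with d_path[OF u(1)] obtain w where w: "(r, w) \<in> ?E ^^ n" "(w, u) \<in> ?E" by auto
    with d_le[OF w(1)] d_step[OF w(2)] n show ?thesis by (intro exI[of _ w]) auto
  qed
  have p: "(p u, u) \<in> ?E" "d u = Suc (d (p u))" if "u \<in> pverts G" "u \<noteq> r" for u
    using someI_ex[OF ex_p[OF that]] unfolding p_def by auto
  \<comment> \<open>Arcs between different layers of depth at most \<open>k\<close>. Following
    parents, \<open>F k\<close> connects any two vertices of depth at most \<open>k\<close> through
    \<open>r\<close>; this supplies the detours that contradict the bridge property.\<close>
  define F where "F k = {(x, y). (x, y) \<in> ?E \<and> d x \<noteq> d y \<and> d x \<le> k \<and> d y \<le> k}" for k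
  have symF: "sym (F k)" for k by (auto simp: F_def sym_def dest: sym)
  have to_r: "(u, r) \<in> (F k)\<^sup>*" if "u \<in> pverts G" "d u \<le> k" for u k
    using that
  proof (induction "d u" arbitrary: u rule: less_induct)
    case less
    show ?case
    proof (cases "u = r")
      case False
      note pu = p[OF less.prems(1) False]
      then have "(u, p u) \<in> F k" using less.prems by (auto simp: F_def dest: sym)
      moreover have "(p u, r) \<in> (F k)\<^sup>*"
        using pu less G.in_arcsD1 by (intro less.hyps) auto
      ultimately show ?thesis by (rule converse_rtrancl_into_rtrancl)
    qed simp
  qed
  have F_conn: "(u, v) \<in> (F k)\<^sup>*" if "u \<in> pverts G" "d u \<le> k" "v \<in> pverts G" "d v \<le> k" for u v k
  proof -
    have "(r, v) \<in> (F k)\<^sup>*"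
      using to_r[OF that(3,4)] sym_rtrancl[OF symF[of k]] by (auto dest: symD)
    with to_r[OF that(1,2)] show ?thesis by (rule rtrancl_trans)
  qed
  \<comment> \<open>An edge inside a layer is not in \<open>F (d u)\<close>, so the detour between
    its ends avoids it.\<close>
  have neq: "d u \<noteq> d v" if uv: "(u, v) \<in> ?E" for u v
  proof
    assume eq: "d u = d v"
    have "(v, u) \<in> (F (d u))\<^sup>*" using uv eq G.in_arcsD1 G.in_arcsD2 by (intro F_conn) auto
    moreover have "F (d u) \<subseteq> ?E - {(u, v), (v, u)}" using eq by (auto simp: F_def)
    ultimately show False using undirected_tree_bridge[OF tree uv] rtrancl_mono by blast
  qed
  \<comment> \<open>The detour from \<open>a\<close> to \<open>b\<close> stays at depth at most
    \<open>d a\<close> and so misses \<open>u\<close>; the arc from \<open>b\<close> to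
    \<open>u\<close> then completes a walk around the edge between \<open>a\<close> and
    \<open>u\<close>.\<close>
  have uniq: "a = b"
    if a: "(a, u) \<in> ?E" "d u = Suc (d a)" and b: "(b, u) \<in> ?E" "d u = Suc (d b)" for a b u
  proof (rule ccontr)
    assume "a \<noteq> b"
    let ?E' = "?E - {(u, a), (a, u)}"
    have "(a, b) \<in> (F (d a))\<^sup>*" using a b G.in_arcsD1 by (intro F_conn) auto
    moreover have "F (d a) \<subseteq> ?E'" using a by (auto simp: F_def)
    ultimately have "(a, b) \<in> ?E'\<^sup>*" using rtrancl_mono by blast
    moreover have "(b, u) \<in> ?E'" using b \<open>a \<noteq> b\<close> by auto
    ultimately have "(a, u) \<in> ?E'\<^sup>*" by (rule rtrancl_into_rtrancl)
    with undirected_tree_bridge[OF tree sym[OF a(1)]] show False by simp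
  qed
  have child: "u \<noteq> r \<and> v = p u" if uv: "(u, v) \<in> ?E" "d v < d u" for u v
  proof -
    have "u \<noteq> r" using uv(2) d_r by auto
    moreover have "d u = Suc (d v)" using d_step[OF sym[OF uv(1)]] uv(2) by simp
    ultimately show ?thesis
      using uniq[OF sym[OF uv(1)] _ p] G.in_arcsD1[OF uv(1)] by blast
  qed
  have "rooted_tree G r p d"
    unfolding rooted_tree_def
  proof (intro conjI ballI allI impI)
    fix u v
    show "(u, v) \<in> ?E \<longleftrightarrow>
        u \<in> pverts G \<and> v \<in> pverts G \<and> (u \<noteq> r \<and> v = p u \<or> v \<noteq> r \<and> u = p v)"
    proof
      assume uv: "(u, v) \<in> ?E"
      then have "d v < d u \<or> d u < d v" using neq by force
      then show "u \<in> pverts G \<and> v \<in> pverts G \<and> (u \<noteq> r \<and> v = p u \<or> v \<noteq> r \<and> u = p v)"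
        using child[OF uv] child[OF sym[OF uv]] G.in_arcsD1[OF uv] G.in_arcsD2[OF uv] by blast
    next
      assume "u \<in> pverts G \<and> v \<in> pverts G \<and> (u \<noteq> r \<and> v = p u \<or> v \<noteq> r \<and> u = p v)"
      then show "(u, v) \<in> ?E" using p(1) sym by blast
    qed
  qed (use r p G.pair_finite_verts G.in_arcsD1 in auto)
  then show ?thesis by blast
qed

text \<open>A path without repeated vertices has fewer arcs than there are vertices. This turns the
  diameter hypothesis into a lower bound on the order.\<close>

lemma diameter_less_card:
  assumes tree: "undirected_tree G"
  shows "diameter G \<le> ereal (real (card (pverts G)) - 1)"
proof -
  have "pair_graph G" using tree by (simp add: undirected_tree_def)
  interpret G: pair_graph G by fact
  have "G.\<mu> (\<lambda>_. 1) u v \<le> ereal (real (card (pverts G)) - 1)"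
    if uv: "u \<in> pverts G" "v \<in> pverts G" for u v
  proof -
    obtain q where q: "G.apath u q v"
      using undirected_tree_reachable[OF tree uv] G.reachable_apath by blast
    then have "length q < card (pverts G)" by (rule G.length_apath_less)
    have "G.\<mu> (\<lambda>_. 1) u v \<le> ereal (G.awalk_cost (\<lambda>_. 1) q)"
      using q by (intro G.min_cost_le_walk_cost) (simp add: G.apath_def)
    also have "G.awalk_cost (\<lambda>_. 1) q = length q" by (induction q) auto
    finally show ?thesis using \<open>length q < card (pverts G)\<close>
      by (simp add: order_trans)
  qed
  then show ?thesis unfolding diameter_def by (intro SUP_least) auto
qed

lemma rooted_tree_sym:
  "rooted_tree G r p d \<Longrightarrow> (u, v) \<in> parcs G \<Longrightarrow> (v, u) \<in> parcs G"
  unfolding rooted_tree_def by blast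

lemma rooted_tree_deepest:
  assumes "rooted_tree G r p d"
  obtains x where "x \<in> pverts G" "\<And>u. u \<in> pverts G \<Longrightarrow> d u \<le> d x"
proof -
  have fin: "finite (d ` pverts G)" and "d ` pverts G \<noteq> {}"
    using assms by (auto simp: rooted_tree_def)
  then have "Max (d ` pverts G) \<in> d ` pverts G" by (rule Max_in)
  then obtain x where "x \<in> pverts G" "d x = Max (d ` pverts G)" by auto
  with fin that show ?thesis by (metis Max_ge imageI)
qed

text \<open>Guarantees that \<open>gamma_tcoi\<close> is an attained minimum and not an unspecified
  \<open>Min {}\<close>. All vertices but a deepest one \<open>x\<close> will do: \<open>x\<close>
  is nobody's parent, so every vertex other than the root is dominated by its parent.\<close>

lemma rooted_tree_ex_coindependent_dominating:
  assumes rt: "rooted_tree G r p d" and card: "3 \<le> card (pverts G)"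
  shows "\<exists>D. total_coindependent_dominating_set G D"
proof -
  have fin: "finite (pverts G)" and r: "r \<in> pverts G"
    and par: "\<And>u. u \<in> pverts G \<Longrightarrow> u \<noteq> r \<Longrightarrow> p u \<in> pverts G \<and> d u = Suc (d (p u))"
    and arc: "\<And>u v. (u, v) \<in> parcs G \<longleftrightarrow>
        u \<in> pverts G \<and> v \<in> pverts G \<and> (u \<noteq> r \<and> v = p u \<or> v \<noteq> r \<and> u = p v)"
    using rt by (auto simp: rooted_tree_def)
  obtain x where x: "x \<in> pverts G" and deepest: "\<And>u. u \<in> pverts G \<Longrightarrow> d u \<le> d x"
    using rooted_tree_deepest[OF rt] by blast
  have no_child: "p u \<noteq> x" if "u \<in> pverts G" "u \<noteq> r" for u
    using par[OF that] deepest[OF that(1)] by auto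
  have "\<not> pverts G \<subseteq> {r, x}"
  proof
    assume "pverts G \<subseteq> {r, x}"
    then have "card (pverts G) \<le> card {r, x}" by (intro card_mono) auto
    also have "\<dots> \<le> 2" by (simp add: card_insert_if)
    finally show False using card by simp
  qed
  then obtain y where y: "y \<in> pverts G" "y \<noteq> r" "y \<noteq> x" by blast
  have dom: "\<exists>u\<in>pverts G - {x}. (w, u) \<in> parcs G" if w: "w \<in> pverts G" for w
  proof (cases "w = r")
    case False
    then show ?thesis using par[OF w False] no_child[OF w False] w arc by blast
  next
    case True
    \<comment> \<open>Climbing from \<open>y\<close> towards the root ends in a child of
      \<open>r\<close>. It is not \<open>x\<close>, since \<open>y \<noteq> x\<close> and
      \<open>x\<close> is nobody's parent.\<close>
    have "\<exists>c\<in>pverts G - {x}. c \<noteq> r \<and> p c = r" if "u \<in> pverts G" "u \<noteq> r" "u \<noteq> x" for u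
      using that
    proof (induction "d u" arbitrary: u rule: less_induct)
      case less
      show ?case
      proof (cases "p u = r")
        case False
        then show ?thesis using less par[of u] no_child[of u] by auto
      qed (use less.prems in blast)
    qed
    from this[OF y] have "\<exists>c\<in>pverts G - {x}. c \<noteq> r \<and> p c = r" .
    with True w arc show ?thesis by blast
  qed
  then have "total_dominating_set G (pverts G - {x})"
    by (simp add: total_dominating_set_def)
  moreover have "independent_set G {x}"
    using x no_child[of x] by (auto simp: independent_set_def arc)
  moreover have "pverts G - (pverts G - {x}) = {x}" using x by blast
  ultimately show ?thesis
    by (intro exI[of _ "pverts G - {x}"]) (simp add: total_coindependent_dominating_set_def)
qed

section \<open>Leaves, and detaching a piece of a rooted tree\<close>

text \<open>Only \<open>y\<close> can dominate \<open>x\<close>, so \<open>y\<close> lies outside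
  \<open>S\<close>. Then \<open>x\<close> could be added to \<open>S\<close>, and maximality puts it
  there.\<close>

lemma co_total_independent_leaf:
  assumes fin: "finite (pverts G)" and sym: "\<And>u v. (u, v) \<in> parcs G \<Longrightarrow> (v, u) \<in> parcs G"
    and wc: "co_total_independent G S" and x: "x \<in> pverts G" and leaf: "parcs G `` {x} = {y}" and "y \<noteq> x"
  shows "x \<in> S" "y \<notin> S"
proof -
  have ind: "independent_set G S" and max: "\<And>B. independent_set G B \<Longrightarrow> card B \<le> card S"
    and td: "\<And>u. u \<in> pverts G \<Longrightarrow> \<exists>w\<in>pverts G - S. (u, w) \<in> parcs G"
    using wc fin by (simp_all add: co_total_independent_def maximum_independent_set_iff total_dominating_set_def)
  have nb: "(x, w) \<in> parcs G \<longleftrightarrow> w = y" for w using leaf by auto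
  then show y: "y \<notin> S" using td[OF x] by auto
  show "x \<in> S"
  proof (rule ccontr)
    assume "x \<notin> S"
    have "(x, u) \<notin> parcs G" "(u, x) \<notin> parcs G" if "u \<in> insert x S" for u
      using that nb sym[of u x] y \<open>y \<noteq> x\<close> by auto
    then have "independent_set G (insert x S)"
      using ind x unfolding independent_set_def by blast
    moreover have "finite S" using ind fin unfolding independent_set_def by (meson finite_subset)
    ultimately show False using max[of "insert x S"] \<open>x \<notin> S\<close> by simp
  qed
qed

text \<open>The assumption \<open>smaller\<close> is the induction hypothesis of a strong induction on the order of
  the tree; the root, the parents and the depths stay fixed because only descendant-closed sets
  of vertices are ever removed.\<close>

locale co_total_rooted_tree =
  fixes G :: "'a pair_pre_digraph" and r :: 'a and p :: "'a \<Rightarrow> 'a" and d :: "'a \<Rightarrow> nat"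
    and S :: "'a set"
  assumes rooted: "rooted_tree G r p d" and wc: "co_total_independent G S"
    and smaller: "\<And>G' S'. card (pverts G') < card (pverts G) \<Longrightarrow> rooted_tree G' r p d \<Longrightarrow>
      co_total_independent G' S' \<Longrightarrow> family_T G'"
begin

abbreviation "V \<equiv> pverts G"
abbreviation "E \<equiv> parcs G"

lemma fin: "finite V" and root: "r \<in> V"
  and par: "u \<in> V \<Longrightarrow> u \<noteq> r \<Longrightarrow> p u \<in> V" "u \<in> V \<Longrightarrow> u \<noteq> r \<Longrightarrow> d u = Suc (d (p u))"
  and arc: "(u, v) \<in> E \<longleftrightarrow> u \<in> V \<and> v \<in> V \<and> (u \<noteq> r \<and> v = p u \<or> v \<noteq> r \<and> u = p v)"
  using rooted unfolding rooted_tree_def by blast+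

lemma sym: "(u, v) \<in> E \<Longrightarrow> (v, u) \<in> E"
  using rooted by (rule rooted_tree_sym)

lemma arc_depth: "(u, v) \<in> E \<Longrightarrow> d u \<noteq> d v"
  using arc[of u v] par(2) by (metis n_not_Suc_n)

lemma no_loop: "(u, u) \<notin> E"
  using arc_depth by blast

lemma ind: "independent_set G S" and S_sub: "S \<subseteq> V"
  and max: "independent_set G B \<Longrightarrow> card B \<le> card S"
  and no_edge: "u \<in> S \<Longrightarrow> v \<in> S \<Longrightarrow> (u, v) \<notin> E"
  and dom: "u \<in> V \<Longrightarrow> \<exists>w\<in>V - S. (u, w) \<in> E"
  using wc fin unfolding co_total_independent_def maximum_independent_set_iff[OF fin]
    independent_set_def total_dominating_set_def by blast+

lemma finS: "finite S"
  using S_sub fin by (rule finite_subset)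

lemma leaf:
  assumes "E `` {x} = {y}"
  shows "x \<in> S" "y \<notin> S"
proof -
  have "(x, y) \<in> E" using assms by blast
  then have "x \<in> V" "y \<noteq> x" using arc no_loop by blast+
  with co_total_independent_leaf[OF fin sym wc _ assms] show "x \<in> S" "y \<notin> S" by blast+
qed

lemma rooted_delete:
  assumes "r \<notin> X" and "\<And>u. u \<in> V \<Longrightarrow> u \<notin> X \<Longrightarrow> u \<noteq> r \<Longrightarrow> p u \<notin> X"
  shows "rooted_tree \<lparr>pverts = V - X, parcs = E \<inter> (V - X) \<times> (V - X)\<rparr> r p d"
  unfolding rooted_tree_def using fin root par arc assms by simp blast

text \<open>The root alone is already independent. This is what passing from \<open>S'\<close> to a
  \<open>gamma_tcoi_set\<close> requires.\<close>

lemma nonempty_S: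
  assumes "rooted_tree G' r p d" "co_total_independent G' S'"
  shows "S' \<noteq> {}"
proof -
  have G': "finite (pverts G')" "r \<in> pverts G'" "(r, r) \<notin> parcs G'"
    using assms(1) unfolding rooted_tree_def by (blast, blast, metis n_not_Suc_n)
  then have "independent_set G' {r}" by (simp add: independent_set_def)
  with assms(2) have "card {r} \<le> card S'"
    unfolding co_total_independent_def maximum_independent_set_iff[OF G'(1)] by blast
  then show ?thesis by auto
qed

text \<open>The common core of undoing the four operations: \<open>H\<close> hangs from
  \<open>p h\<close> by a single edge. \<open>ext\<close> ensures that the part of \<open>S\<close>
  outside \<open>H\<close> stays maximum. \<open>dom_h\<close> concerns the one vertex that could
  lose a dominator: \<open>p h\<close> loses none if \<open>h \<in> S\<close>, and otherwise has
  another one.\<close>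

lemma detach:
  assumes H: "parcs H \<subseteq> pverts H \<times> pverts H" "sym (parcs H)" "pverts H \<subseteq> V" "r \<notin> pverts H"
    and h: "h \<in> pverts H" "p h \<notin> pverts H"
    and nb: "\<And>x y. x \<in> pverts H \<Longrightarrow> (x, y) \<in> E \<longleftrightarrow> (x, y) \<in> parcs H \<or> x = h \<and> y = p h"
    and ext: "\<And>B. B \<subseteq> V - pverts H \<Longrightarrow> independent_set G B \<Longrightarrow>
      card B + card (S \<inter> pverts H) \<le> card S"
    and dom_h: "h \<in> S \<or> (\<exists>u\<in>V - pverts H - S. (p h, u) \<in> E)"
  shows "\<exists>G'. G = join_by_edge G' (p h) H h \<and> pverts G' = V - pverts H \<and> family_T G' \<and>
    maximum_independent_set G' (S - pverts H) \<and> gamma_tcoi_set G' (V - pverts H - S)"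
proof -
  let ?X = "pverts H"
  define G' where "G' = \<lparr>pverts = V - ?X, parcs = E \<inter> (V - ?X) \<times> (V - ?X)\<rparr>"
  have G': "pverts G' = V - ?X" "parcs G' = E \<inter> (V - ?X) \<times> (V - ?X)" by (simp_all add: G'_def)
  have hr: "h \<in> V" "h \<noteq> r" using h H by auto
  have v: "p h \<in> V - ?X" using par(1)[OF hr] h by blast
  have G_eq: "G = join_by_edge G' (p h) H h"
  proof (rule pair_pre_digraph.equality)
    show "V = pverts (join_by_edge G' (p h) H h)" using H(3) by (auto simp: G')
    have "E \<subseteq> parcs G' \<union> parcs H \<union> {(p h, h), (h, p h)}"
    proof
      fix e assume e: "e \<in> E"
      obtain a b where ab: "e = (a, b)" by (cases e)
      have "(b, a) \<in> E" using e ab sym by blast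
      then show "e \<in> parcs G' \<union> parcs H \<union> {(p h, h), (h, p h)}"
        using e ab nb[of a b] nb[of b a] H(2) arc[of a b] unfolding G' by (blast dest: symD)
    qed
    moreover have "parcs G' \<union> parcs H \<union> {(p h, h), (h, p h)} \<subseteq> E"
      using nb H(1) h(1) sym unfolding G' by blast
    ultimately show "E = parcs (join_by_edge G' (p h) H h)"
      unfolding join_by_edge_simps by (rule equalityI)
  qed simp
  have rt: "rooted_tree G' r p d"
    unfolding G'_def
  proof (rule rooted_delete[OF H(4)])
    fix u assume u: "u \<in> V" "u \<notin> ?X" "u \<noteq> r"
    show "p u \<notin> ?X"
    proof
      assume pu: "p u \<in> ?X"
      \<comment> \<open>The only edge leaving \<open>H\<close> joins \<open>h\<close> and
        \<open>p h\<close>, so \<open>u\<close> and \<open>h\<close> would be each other's parents,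
        against the depths.\<close>
      have "(p u, u) \<in> E" using u par(1) arc by blast
      then have "p u = h" "u = p h" using nb[OF pu] H(1) u(2) by blast+
      then show False using par(2)[OF hr] par(2)[OF u(1,3)] by simp
    qed
  qed
  have finG': "finite (pverts G')" using fin by (simp add: G')
  have mis: "maximum_independent_set G' (S - ?X)"
    unfolding maximum_independent_set_iff[OF finG']
  proof (intro conjI allI impI)
    show "independent_set G' (S - ?X)"
      using ind unfolding independent_set_def G' by blast
    fix B assume "independent_set G' B"
    then have "B \<subseteq> V - ?X" "independent_set G B"
      unfolding independent_set_def G' by blast+
    then have "card B + card (S \<inter> ?X) \<le> card S" by (rule ext)
    moreover have "card S = card (S - ?X) + card (S \<inter> ?X)"
      using finS by (metis add.commute card_Int_Diff)
    ultimately show "card B \<le> card (S - ?X)" by linarith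
  qed
  have D': "pverts G' - (S - ?X) = V - ?X - S" by (auto simp: G')
  have "\<exists>w\<in>V - ?X - S. (u, w) \<in> parcs G'" if u: "u \<in> pverts G'" for u
  proof (cases "u = p h \<and> h \<notin> S")
    case True
    with dom_h v show ?thesis unfolding G' by blast
  next
    case False
    have uV: "u \<in> V" "u \<notin> ?X" using u by (auto simp: G')
    then obtain w where w: "w \<in> V - S" "(u, w) \<in> E" using dom by blast
    have "w \<notin> ?X"
    proof
      assume "w \<in> ?X"
      then have "w = h \<and> u = p h" using nb[of w u] sym[OF w(2)] H(1) uV by blast
      then show False using w(1) False by blast
    qed
    with w uV show ?thesis unfolding G' by blast
  qed
  then have wc': "co_total_independent G' (S - ?X)"
    using mis unfolding co_total_independent_def D' total_dominating_set_def G'(1) by blast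
  have "V - ?X \<subset> V" using h H by blast
  then have "card (pverts G') < card V" unfolding G'(1) by (rule psubset_card_mono[OF fin])
  then have "family_T G'" using smaller rt wc' by blast
  moreover have "gamma_tcoi_set G' (V - ?X - S)"
    using co_total_independent_gamma_tcoi_set(1)[OF _ wc' nonempty_S[OF rt wc']] finG' unfolding D' by blast
  ultimately show ?thesis using G_eq G'(1) mis by (intro exI[of _ G']) (intro conjI)
qed

text \<open>\<open>A\<close> has no neighbours outside \<open>X\<close>, so it can be added to any
  independent \<open>B\<close> avoiding \<open>X\<close>. This provides \<open>ext\<close> in
  \<open>detach\<close>; \<open>A\<close> may differ from \<open>S \<inter> X\<close> and only has
  to be at least as large.\<close>

lemma extend:
  assumes "X \<subseteq> V" "A \<subseteq> X" and A: "\<And>a y. a \<in> A \<Longrightarrow> (a, y) \<in> E \<Longrightarrow> y \<in> X - A"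
    and card: "card (S \<inter> X) \<le> card A" and B: "B \<subseteq> V - X" "independent_set G B"
  shows "card B + card (S \<inter> X) \<le> card S"
proof -
  have "(x, y) \<notin> E" if xy: "x \<in> B \<union> A" "y \<in> B \<union> A" for x y
    using xy A[of x y] A[of y x] sym[of x y] B assms(2) unfolding independent_set_def by blast
  then have "independent_set G (B \<union> A)"
    using B assms(1,2) unfolding independent_set_def by blast
  then have "card (B \<union> A) \<le> card S" by (rule max)
  moreover have "finite A" "finite B" "B \<inter> A = {}"
    using B assms(1,2) fin by (auto intro: finite_subset)
  then have "card (B \<union> A) = card B + card A" by (intro card_Un_disjoint)
  ultimately show ?thesis using card by linarith
qed

lemma root_closed:
  assumes "r \<in> X" and "\<And>x y. x \<in> X \<Longrightarrow> (x, y) \<in> E \<Longrightarrow> y \<in> X"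
  shows "V \<subseteq> X"
proof
  fix u assume "u \<in> V"
  then show "u \<in> X"
  proof (induction "d u" arbitrary: u rule: less_induct)
    case less
    show ?case
    proof (cases "u = r")
      case False
      have "p u \<in> X" using less.hyps[of "p u"] par[OF less.prems False] by simp
      moreover have "(p u, u) \<in> E" using par(1)[OF less.prems False] less.prems False arc by blast
      ultimately show ?thesis using assms(2) by blast
    qed (use assms(1) in simp)
  qed
qed

text \<open>The four vertices include the root and are closed under adjacency, so by connectedness
  there are no others.\<close>

lemma P4_family:
  assumes nb: "\<And>y. (a, y) \<in> E \<longleftrightarrow> y = b" "\<And>y. (b, y) \<in> E \<longleftrightarrow> y = a \<or> y = c"
    "\<And>y. (c, y) \<in> E \<longleftrightarrow> y = b \<or> y = e" "\<And>y. (e, y) \<in> E \<longleftrightarrow> y = c"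
    and "distinct [a, b, c, e]" "r \<in> {a, b, c, e}"
  shows "family_T G"
proof -
  have "V \<subseteq> {a, b, c, e}"
    by (rule root_closed[OF assms(6)]) (use nb in auto)
  moreover have "a \<in> V" "b \<in> V" "c \<in> V" "e \<in> V" using nb arc by blast+
  ultimately have V: "V = {a, b, c, e}" by blast
  have "(x, y) \<in> E \<longleftrightarrow> (x, y) \<in> parcs (path_graph [a, b, c, e])" for x y
  proof (cases "x \<in> V")
    case True
    then show ?thesis using nb assms(5) unfolding V by auto
  next
    case False
    then show ?thesis using arc[of x y] unfolding V by auto
  qed
  then have "E = parcs (path_graph [a, b, c, e])" by (metis set_eqI surj_pair)
  then have "G = path_graph [a, b, c, e]"
    using V by (intro pair_pre_digraph.equality) simp_all
  then show ?thesis using family_T.P4[OF assms(5)] by simp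
qed

lemma arc_parent: "u \<in> V \<Longrightarrow> u \<noteq> r \<Longrightarrow> (u, p u) \<in> E" "u \<in> V \<Longrightarrow> u \<noteq> r \<Longrightarrow> (p u, u) \<in> E"
  using arc par(1) by blast+

text \<open>Undoes O1 by removing \<open>x\<close> only, so \<open>x'\<close> may be the root. An
  independent \<open>B\<close> avoiding \<open>x\<close> is smaller than \<open>S\<close>: if
  \<open>y\<close> is not in \<open>B\<close>, then \<open>x\<close> can be added; otherwise
  \<open>y\<close> is exchanged for \<open>x\<close> and \<open>x'\<close>.\<close>

lemma twin_leaves:
  assumes x: "\<And>z. (x, z) \<in> E \<longleftrightarrow> z = y" and x': "\<And>z. (x', z) \<in> E \<longleftrightarrow> z = y"
    and "x \<noteq> x'" "x \<noteq> r"
  shows "family_T G"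
proof -
  have V: "x \<in> V" "x' \<in> V" using x x' arc by blast+
  have "(x, p x) \<in> E" using arc_parent(1) V \<open>x \<noteq> r\<close> by blast
  then have px: "p x = y" using x by blast
  have xr: "(z, x) \<in> E \<longleftrightarrow> z = y" "(z, x') \<in> E \<longleftrightarrow> z = y" for z using x x' sym by blast+
  have "x \<noteq> y" "x' \<noteq> y" using x x' no_loop by blast+
  have xS: "x \<in> S" "y \<notin> S" using leaf[of x y] x by auto
  have yV: "y \<in> V" using x arc by blast
  let ?H = "path_graph [x]"
  have ext: "card B + card (S \<inter> pverts ?H) \<le> card S"
    if B: "B \<subseteq> V - pverts ?H" "independent_set G B" for B
  proof -
    have finB: "finite B" using B fin by (meson Diff_subset finite_subset)
    have xB: "x \<notin> B" using B(1) by auto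
    have BE: "(u, w) \<notin> E" if "u \<in> B" "w \<in> B" for u w
      using B that unfolding independent_set_def by blast
    have "Suc (card B) \<le> card S"
    proof (cases "y \<in> B")
      case False
      have "independent_set G (insert x B)"
        unfolding independent_set_def using False B(1) V BE x xr \<open>x \<noteq> y\<close> by auto
      from max[OF this] show ?thesis using xB finB by simp
    next
      case True
      have x'B: "x' \<notin> B" using BE[OF _ True] x' by blast
      have "independent_set G (insert x (insert x' (B - {y})))"
        unfolding independent_set_def
        using B(1) V BE x x' xr \<open>x \<noteq> y\<close> \<open>x' \<noteq> y\<close> by auto
      moreover have "card (insert x (insert x' (B - {y}))) = Suc (card B)"
        using x'B xB finB True \<open>x \<noteq> x'\<close> card_Suc_Diff1[OF finB True] by simp
      ultimately show ?thesis using max by metis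
    qed
    then show ?thesis using xS by simp
  qed
  have "\<exists>G'. G = join_by_edge G' (p x) ?H x \<and> pverts G' = V - pverts ?H \<and> family_T G' \<and>
    maximum_independent_set G' (S - pverts ?H) \<and> gamma_tcoi_set G' (V - pverts ?H - S)"
  proof (rule detach[of ?H x])
    fix B assume "B \<subseteq> V - pverts ?H" "independent_set G B"
    then show "card B + card (S \<inter> pverts ?H) \<le> card S" by (rule ext)
  qed (use V xS \<open>x \<noteq> r\<close> \<open>x \<noteq> y\<close> x px in \<open>auto simp: sym_def\<close>)
  then obtain G' where G': "G = join_by_edge G' (p x) ?H x" "pverts G' = V - pverts ?H"
    "family_T G'" "gamma_tcoi_set G' (V - pverts ?H - S)" by blast
  have "family_T (join_by_edge G' (p x) (path_graph [x]) x)"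
    by (rule family_T.O1[OF G'(3,4)]) (use G'(2) px xS yV \<open>x \<noteq> y\<close> in auto)
  then show ?thesis using G'(1) by simp
qed

definition deepest :: "'a \<Rightarrow> bool" where
  "deepest u \<longleftrightarrow> u \<in> V \<and> (\<forall>w\<in>V. d w \<le> d u)"

lemma deepest_leaf:
  assumes u: "deepest u"
  shows "u \<in> V" "u \<noteq> r" "(u, z) \<in> E \<longleftrightarrow> z = p u"
proof -
  show uV: "u \<in> V" using u by (simp add: deepest_def)
  have no_child: "p w \<noteq> u" if "w \<in> V" "w \<noteq> r" for w
    using u par(2)[OF that] that(1) by (auto simp: deepest_def)
  show ur: "u \<noteq> r"
  proof
    assume "u = r"
    then obtain w where "(r, w) \<in> E" using dom uV by blast
    then show False using arc[of r w] no_child[of w] \<open>u = r\<close> by blast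
  qed
  show "(u, z) \<in> E \<longleftrightarrow> z = p u"
    using arc[of u z] no_child[of z] uV ur par(1)[of u] by blast
qed

lemma deepest_same_depth: "deepest u \<Longrightarrow> w \<in> V \<Longrightarrow> d w = d u \<Longrightarrow> deepest w"
  by (simp add: deepest_def)

section \<open>Structure around a deepest vertex of a tree outside the family\<close>

context
  assumes not_family: "\<not> family_T G"
begin

text \<open>A sibling of \<open>u\<close> would be equally deep, hence a twin leaf. So
  \<open>p u\<close> has no other child, and as \<open>u \<in> S\<close>, its dominator outside
  \<open>S\<close> must be its parent, which therefore exists.\<close>

lemma deepest_arm:
  assumes u: "deepest u"
  shows "p u \<in> V" "p u \<noteq> r" "u \<in> S" "p u \<notin> S" "p (p u) \<in> V" "p (p u) \<notin> S"
    and "(p u, z) \<in> E \<longleftrightarrow> z = u \<or> z = p (p u)"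
    and "d u = Suc (d (p u))" "d (p u) = Suc (d (p (p u)))"
proof -
  note lu = deepest_leaf[OF u]
  show pu: "p u \<in> V" and du: "d u = Suc (d (p u))" using par lu by blast+
  have "E `` {u} = {p u}" using lu(3) by auto
  from leaf[OF this] show uS: "u \<in> S" "p u \<notin> S" .
  have only: "c = u" if c: "c \<in> V" "c \<noteq> r" "p c = p u" for c
  proof (rule ccontr)
    assume "c \<noteq> u"
    have "deepest c" using deepest_same_depth[OF u c(1)] par(2)[OF c(1,2)] c(3) du by simp
    from deepest_leaf(3)[OF this] c(3) have "(c, z) \<in> E \<longleftrightarrow> z = p u" for z by simp
    from twin_leaves[OF lu(3) this \<open>c \<noteq> u\<close>[symmetric] lu(2)] show False using not_family by blast
  qed
  obtain w where w: "w \<in> V - S" "(p u, w) \<in> E" using dom[OF pu] by blast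
  show pr: "p u \<noteq> r"
  proof
    assume "p u = r"
    then have "w = u" using w(2) arc[of "p u" w] only[of w] by metis
    then show False using w(1) uS by blast
  qed
  show "p (p u) \<in> V" "d (p u) = Suc (d (p (p u)))" using par[OF pu pr] by blast+
  show nb: "(p u, z) \<in> E \<longleftrightarrow> z = u \<or> z = p (p u)" for z
    using arc[of "p u" z] only[of z] pu pr par(1)[OF pu pr] lu(1,2) by metis
  show "p (p u) \<notin> S" using nb[of w] w uS by auto
qed

text \<open>A neighbour \<open>z\<close> outside \<open>S\<close> would still dominate
  \<open>p (p u)\<close> after the removal of \<open>p u\<close> and \<open>u\<close>, so O2 could
  be undone.\<close>

lemma grandparent_neighbours:
  assumes u: "deepest u" and z: "(p (p u), z) \<in> E" "z \<noteq> p u"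
  shows "z \<in> S"
proof (rule ccontr)
  assume "z \<notin> S"
  note lu = deepest_leaf[OF u] and au = deepest_arm[OF u]
  let ?H = "path_graph [p u, u]"
  have ne: "p u \<noteq> u" "p (p u) \<noteq> u" "p (p u) \<noteq> p u" 
    using au(8,9) by (metis n_not_Suc_n less_irrefl lessI less_SucI)+
  have z': "z \<in> V" "z \<noteq> u" using z(1) arc[of "p (p u)" z] lu(3)[of "p (p u)"] sym[OF z(1)] ne by blast+
  have SH: "S \<inter> pverts ?H = {u}" using au by auto
  have "\<exists>G'. G = join_by_edge G' (p (p u)) ?H (p u) \<and> pverts G' = V - pverts ?H \<and> family_T G' \<and>
    maximum_independent_set G' (S - pverts ?H) \<and> gamma_tcoi_set G' (V - pverts ?H - S)"
  proof (rule detach[of ?H "p u"])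
    fix B assume B: "B \<subseteq> V - pverts ?H" "independent_set G B"
    show "card B + card (S \<inter> pverts ?H) \<le> card S"
      by (rule extend[of _ "{u}"]) (use B SH au lu ne in auto)
  next
    show "p u \<in> S \<or> (\<exists>w\<in>V - pverts ?H - S. (p (p u), w) \<in> E)"
      using z z' \<open>z \<notin> S\<close> by auto
  next
    fix x y assume "x \<in> pverts ?H"
    then show "(x, y) \<in> E \<longleftrightarrow> (x, y) \<in> parcs ?H \<or> x = p u \<and> y = p (p u)"
      using au(7) lu(3) ne by auto
  qed (use au lu ne in \<open>auto simp: sym_def\<close>)
  then obtain G' where G': "G = join_by_edge G' (p (p u)) ?H (p u)" "pverts G' = V - pverts ?H"
    "family_T G'" "gamma_tcoi_set G' (V - pverts ?H - S)" by blast
  have "family_T (join_by_edge G' (p (p u)) ?H (p u))"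
    by (rule family_T.O2[OF G'(3,4)]) (use G'(2) au ne in auto)
  then show False using G'(1) not_family by simp
qed

lemma deepest_depth:
  assumes "deepest u"
  shows "p u \<noteq> u" "p (p u) \<noteq> u" "p (p u) \<noteq> p u"
    and "p (p u) \<noteq> r \<Longrightarrow> p (p (p u)) \<noteq> u" "p (p u) \<noteq> r \<Longrightarrow> p (p (p u)) \<noteq> p u"
    and "p (p u) \<noteq> r \<Longrightarrow> p (p (p u)) \<noteq> p (p u)"
proof -
  note au = deepest_arm[OF assms]
  have lt: "x \<noteq> y" if "d x < d y" for x y using that by blast
  show "p u \<noteq> u" "p (p u) \<noteq> u" "p (p u) \<noteq> p u"
    by (rule lt, use au(8,9) in linarith)+
  assume "p (p u) \<noteq> r"
  from par(2)[OF au(5) this] au(8,9)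
  show "p (p (p u)) \<noteq> u" "p (p (p u)) \<noteq> p u" "p (p (p u)) \<noteq> p (p u)"
    by (intro lt; linarith)+
qed

text \<open>By \<open>grandparent_neighbours\<close>, \<open>c \<in> S\<close>. A child of
  \<open>c\<close> would be as deep as \<open>u\<close>, but parents of deepest vertices lie outside
  \<open>S\<close>.\<close>

lemma grandparent_child_leaf:
  assumes u: "deepest u" and c: "c \<in> V" "c \<noteq> r" "p c = p (p u)" "c \<noteq> p u"
  shows "(c, z) \<in> E \<longleftrightarrow> z = p (p u)"
proof -
  note au = deepest_arm[OF u]
  have cS: "c \<in> S"
    using grandparent_neighbours[OF u _ c(4)] arc_parent(2)[OF c(1,2)] c(3) by simp
  have dc: "d c = d (p u)" using par(2)[OF c(1,2)] c(3) au(9) by simp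
  have no_child: "p e \<noteq> c" if e: "e \<in> V" "e \<noteq> r" for e
  proof
    assume "p e = c"
    then have "deepest e" using deepest_same_depth[OF u e(1)] par(2)[OF e] dc au(8) by simp
    from deepest_arm(4)[OF this] show False using \<open>p e = c\<close> cS by simp
  qed
  show ?thesis
    using arc[of c z] no_child[of z] c(1-3) par(1)[OF c(1,2)] by metis
qed

text \<open>A second child \<open>c\<close> is a leaf, and a third would be its twin. Then
  \<open>c\<close>, \<open>x2\<close>, \<open>x1\<close>, \<open>u\<close> form either the whole
  tree or a path joined at \<open>x2\<close> to \<open>x3 \<in> S\<close>, and O4 can be
  undone.\<close>

lemma grandparent_single_child:
  assumes u: "deepest u" and c: "c \<in> V" "c \<noteq> r" "p c = p (p u)"
  shows "c = p u"
proof (rule ccontr)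
  assume cne: "c \<noteq> p u"
  note lu = deepest_leaf[OF u] and au = deepest_arm[OF u]
  note nc = grandparent_child_leaf[OF u c cne]
  define x1 x2 where "x1 = p u" and "x2 = p x1"
  have cu: "c \<noteq> u" using lu(3)[of "p u"] nc[of "p u"] deepest_depth(3)[OF u] by metis
  have cx2: "c \<noteq> x2" using nc[of x2] no_loop[of x2] unfolding x1_def x2_def by auto
  have dist: "distinct [c, x2, x1, u]"
    using deepest_depth[OF u] cne cu cx2 unfolding x1_def x2_def by simp
  have nb: "(u, y) \<in> E \<longleftrightarrow> y = x1" "(x1, y) \<in> E \<longleftrightarrow> y = u \<or> y = x2" "(c, y) \<in> E \<longleftrightarrow> y = x2" for y
    using lu(3) au(7) nc unfolding x1_def x2_def by blast+
  have only: "e = x1 \<or> e = c" if e: "e \<in> V" "e \<noteq> r" "p e = x2" for e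
  proof (rule ccontr)
    assume ne: "\<not> (e = x1 \<or> e = c)"
    then have "(e, z) \<in> E \<longleftrightarrow> z = x2" for z
      using grandparent_child_leaf[OF u, of e z] e unfolding x1_def x2_def by blast
    from twin_leaves[OF nb(3) this] show False using ne c(2) not_family by blast
  qed
  have cS: "c \<in> S" using leaf(1)[of c x2] nb(3) by auto
  have inV: "u \<in> V" "x1 \<in> V" "x2 \<in> V" "c \<in> V" "u \<noteq> r" "x1 \<noteq> r"
    using lu au c unfolding x1_def x2_def by blast+
  have S: "u \<in> S" "x1 \<notin> S" "x2 \<notin> S" using au unfolding x1_def x2_def by blast+
  have nb2: "(x2, y) \<in> E \<longleftrightarrow> y = c \<or> y = x1 \<or> x2 \<noteq> r \<and> y = p x2" for y
    using arc[of x2 y] only[of y] inV c par(1)[of x2] unfolding x1_def x2_def by metis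
  show False
  proof (cases "x2 = r")
    case True
    have "family_T G"
      by (rule P4_family[of c x2 x1 u]) (use nb nb2 True dist in auto)
    then show False using not_family by blast
  next
    case False
    define x3 where "x3 = p x2"
    have x3: "x3 \<in> V" using par(1)[OF inV(3) False] unfolding x3_def .
    have d3: "x3 \<noteq> u" "x3 \<noteq> x1" "x3 \<noteq> x2"
      using deepest_depth(4-6)[OF u] False unfolding x1_def x2_def x3_def by blast+
    have nb2: "(x2, y) \<in> E \<longleftrightarrow> y = c \<or> y = x1 \<or> y = x3" for y
      using nb2 False unfolding x3_def by blast
    have x3S: "x3 \<in> S"
      using grandparent_neighbours[OF u, of x3] nb2[of x3] d3 unfolding x1_def x2_def by blast
    have "x3 \<noteq> c"
    proof
      assume "x3 = c"
      then have "d c = Suc (d x2)" "d x2 = Suc (d c)"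
        using par(2)[OF c(1,2)] c(3) par(2)[OF inV(3) False] unfolding x1_def x2_def x3_def by auto
      then show False by simp
    qed
    \<comment> \<open>Since \<open>x2 \<notin> S\<close> is detached, \<open>x3\<close> needs
      another dominator. If \<open>x2\<close> were its only neighbour, \<open>x3\<close> would be a
      leaf and a twin of \<open>c\<close>. Any further neighbour is outside \<open>S\<close> because
      \<open>x3 \<in> S\<close>.\<close>
    have "\<exists>z. (x3, z) \<in> E \<and> z \<noteq> x2"
    proof (rule ccontr)
      assume "\<not> ?thesis"
      moreover have "(x3, x2) \<in> E" using nb2 sym by blast
      ultimately have "(x3, z) \<in> E \<longleftrightarrow> z = x2" for z by blast
      from twin_leaves[OF nb(3) this \<open>x3 \<noteq> c\<close>[symmetric] c(2)] show False using not_family by blast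
    qed
    then obtain z where z: "(x3, z) \<in> E" "z \<noteq> x2" by blast
    have z': "z \<in> V" "z \<notin> S" "z \<notin> {c, x2, x1, u}"
      using z arc[of x3 z] no_edge[OF x3S, of z] nb[of x3] sym[OF z(1)] d3 by blast+
    let ?H = "path_graph [c, x2, x1, u]"
    have SH: "S \<inter> pverts ?H = {c, u}" using S cS by auto
    have "\<exists>G'. G = join_by_edge G' (p x2) ?H x2 \<and> pverts G' = V - pverts ?H \<and> family_T G' \<and>
      maximum_independent_set G' (S - pverts ?H) \<and> gamma_tcoi_set G' (V - pverts ?H - S)"
    proof (rule detach[of ?H x2])
      fix B assume B: "B \<subseteq> V - pverts ?H" "independent_set G B"
      show "card B + card (S \<inter> pverts ?H) \<le> card S"
        unfolding SH
        by (rule extend[of "pverts ?H" "{c, u}", unfolded SH]) (use B inV nb dist in auto)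
    next
      show "x2 \<in> S \<or> (\<exists>w\<in>V - pverts ?H - S. (p x2, w) \<in> E)"
        using z z' unfolding x3_def by auto
    next
      fix x y assume "x \<in> pverts ?H"
      then consider "x = c" | "x = x2" | "x = x1" | "x = u" by auto
      then show "(x, y) \<in> E \<longleftrightarrow> (x, y) \<in> parcs ?H \<or> x = x2 \<and> y = p x2"
        by cases (use nb nb2 dist in \<open>auto simp: x3_def\<close>)
    next
      show "p x2 \<notin> pverts ?H" using d3 \<open>x3 \<noteq> c\<close> unfolding x3_def by simp
    next
      show "parcs ?H \<subseteq> pverts ?H \<times> pverts ?H" using parcs_path_graph_subset by simp
    qed (use inV c(2) False in \<open>auto simp: sym_def\<close>)
    then obtain G' where G': "G = join_by_edge G' x3 ?H x2" "pverts G' = V - pverts ?H"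
      "family_T G'" "maximum_independent_set G' (S - pverts ?H)" unfolding x3_def by blast
    have "family_T (join_by_edge G' x3 ?H x2)"
      by (rule family_T.O4[OF G'(3,4)]) (use G'(2) x3S d3 \<open>x3 \<noteq> c\<close> dist in auto)
    then show False using G'(1) not_family by simp
  qed
qed

lemma not_family_absurd: False
proof -
  obtain u where "u \<in> V" "\<And>w. w \<in> V \<Longrightarrow> d w \<le> d u"
    using rooted_tree_deepest[OF rooted] by blast
  then have u: "deepest u" by (simp add: deepest_def)
  note lu = deepest_leaf[OF u] and au = deepest_arm[OF u]
  define x1 x2 where "x1 = p u" and "x2 = p x1"
  have inV: "u \<in> V" "x1 \<in> V" "x2 \<in> V" "u \<noteq> r" "x1 \<noteq> r"
    using lu au unfolding x1_def x2_def by blast+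
  have S: "u \<in> S" "x1 \<notin> S" "x2 \<notin> S" using au unfolding x1_def x2_def by blast+
  have nb: "(u, y) \<in> E \<longleftrightarrow> y = x1" "(x1, y) \<in> E \<longleftrightarrow> y = u \<or> y = x2" for y
    using lu(3) au(7) unfolding x1_def x2_def by blast+
  have single: "(x2, y) \<in> E \<longleftrightarrow> y = x1 \<or> x2 \<noteq> r \<and> y = p x2" for y
    using arc[of x2 y] grandparent_single_child[OF u, of y] inV par(1)[of x2]
    unfolding x1_def x2_def by metis
  \<comment> \<open>As the root, \<open>x2\<close> would be a leaf, and leaves lie in
    \<open>S\<close>.\<close>
  have x2r: "x2 \<noteq> r"
  proof
    assume "x2 = r"
    then have "E `` {x2} = {x1}" using single by auto
    from leaf(1)[OF this] S show False by blast
  qed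
  define x3 where "x3 = p x2"
  have x3: "x3 \<in> V" "d x2 = Suc (d x3)" using par[OF inV(3) x2r] unfolding x3_def by blast+
  have d3: "x3 \<noteq> u" "x3 \<noteq> x1" "x3 \<noteq> x2" "u \<noteq> x1" "u \<noteq> x2" "x1 \<noteq> x2"
    using deepest_depth[OF u] x2r unfolding x1_def x2_def x3_def by auto
  have nb2: "(x2, y) \<in> E \<longleftrightarrow> y = x1 \<or> y = x3" for y
    using single x2r unfolding x3_def by blast
  have x3S: "x3 \<in> S"
    using grandparent_neighbours[OF u, of x3] nb2[of x3] d3 unfolding x1_def x2_def by blast
  have only: "w = x2" if w: "w \<in> V" "w \<noteq> r" "p w = x3" for w
  proof (rule ccontr)
    assume ne: "w \<noteq> x2"
    have wS: "w \<notin> S" using arc_parent(2)[OF w(1,2)] w(3) no_edge[OF x3S] by auto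
    have dw: "d w = d x2" using par(2)[OF w(1,2)] w(3) x3(2) by simp
    \<comment> \<open>The dominator \<open>y\<close> of \<open>w\<close> is a child, because the
      parent \<open>x3\<close> is in \<open>S\<close>. Being outside \<open>S\<close>, it is no leaf
      and has a child \<open>t\<close>, which by depth is deepest; so
      \<open>grandparent_single_child\<close> leaves \<open>w\<close> no child but
      \<open>y\<close>.\<close>
    obtain y where y: "y \<in> V - S" "(w, y) \<in> E" using dom[OF w(1)] by blast
    then have "y \<noteq> p w" using w(3) x3S by blast
    then have yw: "y \<noteq> r" "p y = w" using y(2) arc[of w y] by blast+
    have "\<exists>t. t \<in> V \<and> t \<noteq> r \<and> p t = y"
    proof (rule ccontr)
      assume "\<not> ?thesis"
      then have "(y, z) \<in> E \<longleftrightarrow> z = w" for z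
        using arc[of y z] yw y(1) w(1) by blast
      then have "E `` {y} = {w}" by auto
      from leaf(1)[OF this] y(1) show False by blast
    qed
    then obtain t where t: "t \<in> V" "t \<noteq> r" "p t = y" by blast
    have "d t = d u"
      using par(2)[OF t(1,2)] t(3) par(2)[of y] y(1) yw dw par(2)[OF inV(1,4)] par(2)[OF inV(2,5)]
      unfolding x1_def x2_def by simp
    then have td: "deepest t" using deepest_same_depth[OF u t(1)] by blast
    have nbw: "z = y \<or> z = x3" if "(w, z) \<in> E" for z
      using that arc[of w z] grandparent_single_child[OF td, of z] t(3) yw w by metis
    \<comment> \<open>Exchanging \<open>x3\<close> for its two children \<open>x2\<close> and \<open>w\<close> would enlarge \<open>S\<close>.\<close>
    let ?S = "insert x2 (insert w (S - {x3}))"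
    have wx2: "(w, x2) \<notin> E" "(x2, w) \<notin> E"
      using arc_depth[of w x2] arc_depth[of x2 w] dw by auto
    have xs: "(x2, z) \<notin> E" "(z, x2) \<notin> E" "(w, z) \<notin> E" "(z, w) \<notin> E" if "z \<in> S - {x3}" for z
      using that nb2[of z] nbw[of z] sym[of z x2] sym[of z w] S(2) y(1) by auto
    have "independent_set G ?S"
      unfolding independent_set_def
    proof (intro conjI ballI)
      show "?S \<subseteq> V" using inV w S_sub by auto
      fix a b assume "a \<in> ?S" "b \<in> ?S"
      then show "(a, b) \<notin> E" using wx2 xs no_loop no_edge by auto
    qed
    from max[OF this] have "card ?S \<le> card S" .
    moreover have "card ?S = Suc (card S)"
      using ne wS S(3) finS card_Suc_Diff1[OF finS x3S] by simp
    ultimately show False by simp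
  qed
  have nb3: "(x3, y) \<in> E \<longleftrightarrow> y = x2 \<or> x3 \<noteq> r \<and> y = p x3" for y
    using arc[of x3 y] only[of y] inV(3) x2r x3 par(1)[of x3] unfolding x3_def by metis
  have dist: "distinct [x3, x2, x1, u]" using d3 by auto
  have "family_T G"
  proof (cases "x3 = r")
    case True
    show ?thesis
      by (rule P4_family[of x3 x2 x1 u]) (use nb nb2 nb3 True dist in auto)
  next
    case False
    define x4 where "x4 = p x3"
    have x4: "x4 \<in> V" "d x3 = Suc (d x4)" using par[OF x3(1) False] unfolding x4_def by blast+
    have nb3: "(x3, y) \<in> E \<longleftrightarrow> y = x2 \<or> y = x4" for y
      using nb3 False unfolding x4_def by blast
    have x4S: "x4 \<notin> S" using nb3[of x4] no_edge[OF x3S] by blast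
    have "d x4 < d x3" "d x4 < d x2" "d x4 < d x1" "d x4 < d u"
      using x4(2) x3(2) au(8,9) unfolding x1_def x2_def by linarith+
    then have d4: "x4 \<notin> {x3, x2, x1, u}" by blast
    let ?H = "path_graph [x3, x2, x1, u]"
    have SH: "S \<inter> pverts ?H = {x3, u}" using S x3S by auto
    have "\<exists>G'. G = join_by_edge G' (p x3) ?H x3 \<and> pverts G' = V - pverts ?H \<and> family_T G' \<and>
      maximum_independent_set G' (S - pverts ?H) \<and> gamma_tcoi_set G' (V - pverts ?H - S)"
    proof (rule detach[of ?H x3])
      fix B assume B: "B \<subseteq> V - pverts ?H" "independent_set G B"
      \<comment> \<open>\<open>S\<close> meets the path in \<open>x3\<close> and \<open>u\<close>,
        but \<open>x3\<close> has the outside neighbour \<open>x4\<close>, possibly in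
        \<open>B\<close>. Exchanging \<open>x3\<close> for \<open>x2\<close> keeps the count and all
        neighbours inside the path.\<close>
      show "card B + card (S \<inter> pverts ?H) \<le> card S"
        unfolding SH
        by (rule extend[of "pverts ?H" "{x2, u}", unfolded SH]) (use B inV x3 nb nb2 dist in auto)
    next
      show "x3 \<in> S \<or> (\<exists>w\<in>V - pverts ?H - S. (p x3, w) \<in> E)" using x3S by blast
    next
      fix x y assume "x \<in> pverts ?H"
      then consider "x = x3" | "x = x2" | "x = x1" | "x = u" by auto
      then show "(x, y) \<in> E \<longleftrightarrow> (x, y) \<in> parcs ?H \<or> x = x3 \<and> y = p x3"
        by cases (use nb nb2 nb3 dist in \<open>auto simp: x4_def\<close>)
    next
      show "p x3 \<notin> pverts ?H" using d4 unfolding x4_def by simp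
    next
      show "parcs ?H \<subseteq> pverts ?H \<times> pverts ?H" using parcs_path_graph_subset by simp
    qed (use inV x3 x2r False in \<open>auto simp: sym_def\<close>)
    then obtain G' where G': "G = join_by_edge G' x4 ?H x3" "pverts G' = V - pverts ?H"
      "family_T G'" "gamma_tcoi_set G' (V - pverts ?H - S)" unfolding x4_def by blast
    have "family_T (join_by_edge G' x4 ?H x3)"
      by (rule family_T.O3[OF G'(3,4)]) (use G'(2) x4 x4S d4 dist in auto)
    then show ?thesis using G'(1) by simp
  qed
  then show False using not_family by blast
qed

end

end

section \<open>Induction on the order and the equivalence\<close>

lemma co_total_independent_family_T:
  assumes "rooted_tree G r p d" "co_total_independent G S"
  shows "family_T G"
  using assms
proof (induction "card (pverts G)" arbitrary: G S rule: less_induct)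
  case less
  interpret co_total_rooted_tree G r p d S
    using less by unfold_locales
  show ?case using not_family_absurd by blast
qed

theorem theorem5:
  fixes T :: "'a pair_pre_digraph" and n :: nat
  assumes "undirected_tree T"
    and "card (pverts T) = n"
    and "diameter T \<ge> 3"
  shows "gamma_tcoi T = n - independence_number T \<longleftrightarrow> family_T T"
proof
  assume "family_T T"
  then show "gamma_tcoi T = n - independence_number T"
    using family_T_co_total_independent co_total_independent_gamma_tcoi_set(2) assms(2) by blast
next
  assume eq: "gamma_tcoi T = n - independence_number T"
  have "(3 :: ereal) \<le> ereal (real n - 1)"
    using diameter_less_card[OF assms(1)] assms(2,3) by (metis order_trans)
  then have n: "3 \<le> card (pverts T)" using assms(2) by (simp add: numeral_eq_ereal)
  then obtain r where "r \<in> pverts T" by fastforce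
  then obtain p d where rt: "rooted_tree T r p d"
    using undirected_tree_rooted[OF assms(1)] by blast
  then have fin: "finite (pverts T)" by (simp add: rooted_tree_def)
  \<comment> \<open>Only an attained minimum lets the equation speak about the structure of
    \<open>T\<close>.\<close>
  obtain D where "gamma_tcoi_set T D"
    using rooted_tree_ex_coindependent_dominating[OF rt n] gamma_tcoi_set_min(1)[OF fin] by blast
  then have "co_total_independent T (pverts T - D)"
    using gamma_tcoi_set_co_total_independent[OF fin] eq assms(2) by blast
  with rt show "family_T T" by (rule co_total_independent_family_T)
qed

end
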